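(* Let $d\ge 1$ and let $f\in\mathcal{S}_d$ be a Schur function with Schur parameters $r:\mathbb{Z}_+\to\overline{\mathbb{D}}$, variable allocation map $\nu:\mathbb{Z}_{>0}\to\{1,\dots,d\}$ and convergents $f_n$ $(n\ge 1)$. Then $f_n\to f$ uniformly on compact subsets of $\mathbb{D}^d$, and $$f(z)=\sum_{\alpha\in A}c_\alpha(r)\,(z\circ\nu)^\alpha\qquad(z\in\mathbb{D}^d),$$ with the series converging uniformly on compact sets in $\mathbb{D}^d$ (the series being read as the Taylor series of $f$, i.e. as the limit as $m\to\infty$ of the partial sums over $\alpha\in A$ with $|\alpha|=\sum_j\alpha_j\le m$, each of which has only finitely many nonzero terms).
   Context: Notation. $\mathbb{D}$ is the open unit disk in $\mathbb{C}$, $\overline{\mathbb{D}}$ its closure, $\mathbb{T}$ the unit circle, $\mathbb{Z}_+$ the nonnegative integers, $\mathbb{Z}_{>0}$ the positive integers. $\mathcal{H}_d$ is the set of all holomorphic functions $h:\mathbb{D}^d\to\overline{\mathbb{D}}$, with the topology of uniform convergence on compact sets. $\mathbf{c}_r\in\mathcal{H}_d$ denotes the constant function with value $r\in\overline{\mathbb{D}}$. For $1\le j\le d$ and $r\in\overline{\mathbb{D}}$ define operators on $\mathcal{H}_d$ by $(\mathfrak{m}_jh)(z)=z_jh(z)$; $(\mathfrak{g}_rh)(z)=\frac{h(z)+r}{1+\overline{r}h(z)}$ if $r\in\mathbb{D}$, and $\mathfrak{g}_rh=\mathbf{c}_r$ if $r\in\mathbb{T}$. Schur functions. $\mathcal{S}_d$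 is the closure in $\mathcal{H}_d$ of the set of all functions $\mathfrak{g}_{r_0}\mathfrak{m}_{\nu_1}\mathfrak{g}_{r_1}\mathfrak{m}_{\nu_2}\cdots\mathfrak{g}_{r_{k-1}}\mathfrak{m}_{\nu_k}\mathbf{c}_0$ with $k\ge1$, $r_i\in\mathbb{D}$, $\nu_i\in\{1,\dots,d\}$. Elements of $\mathcal{S}_d$ are called Schur functions. Continued fraction expansion. Every $f\in\mathcal{S}_d$ can be written $f=\mathfrak{g}_r\mathfrak{m}_jh$ with $r=f(0)$, some $1\le j\le d$ and some $h\in\mathcal{S}_d$. Starting with $h_0=f$, iterate: given $h_n\in\mathcal{S}_d$, set $r_n=h_n(0)$ and choose $\nu_{n+1}\in\{1,\dots,d\}$ and $h_{n+1}\in\mathcal{S}_d$ with $h_n=\mathfrak{g}_{r_n}\mathfrak{m}_{\nu_{n+1}}h_{n+1}$ (if $h_n$ is constant, take $\nu_{n+1}=1$, $h_{n+1}=\mathbf{c}_0$). The $r_n$ $(n\ge0)$ are the Schur parameters of $f$, $\nu$ is the variable allocation map (not necessarily unique; any choice is allowed), and $f_n=\mathfrak{g}_{r_0}\mathfrak{m}_{\nu_1}\mathfrak{g}_{r_1}\cdots\mathfrak{m}_{\nu_n}\mathfrak{g}_{r_n}\mathbf{c}_0$ is the $n$th convergent. Scattering polynomials. For $(p,q)\in\mathbb{Z}_+^2$ define $\varphi^{(p,q)}:\mathbb{C}\to\mathbb{C}$: if $p,q\ge1$, $$\varphi^{(p,q)}(z)=\frac{(-1)^p}{q\,(p+q-1)!}(1-z\bar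 z)\frac{\partial^{p+q}}{\partial\bar z^p\partial z^q}(1-z\bar z)^{p+q-1}=\sum_{j=1}^{\min\{p,q\}}\binom{p}{j}\binom{q-1}{j-1}z^{p-j}(-\bar z)^{q-j}(1-z\bar z)^j;$$ $\varphi^{(0,q)}=0$ if $q\ge1$; $\varphi^{(p,0)}(z)=z^p$ for $p\ge0$ (with $z^0=1$ even if $z=0$). Scattering weights. $A$ is the set of all finitely supported $\alpha:\mathbb{Z}_{>0}\to\mathbb{Z}_+$. For $\alpha\in A$ put $n=0$ if $\alpha=0$ and $n=\max\operatorname{supp}\alpha$ otherwise, and for $r:\mathbb{Z}_+\to\overline{\mathbb{D}}$ set $c_\alpha(r)=\varphi^{(1,\alpha_1)}(r_0)\prod_{j=1}^n\varphi^{(\alpha_j,\alpha_{j+1})}(r_j)$. Also $(z\circ\nu)^\alpha=\prod_{j\ge1}z_{\nu_j}^{\alpha_j}$. *)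

theory Defs
  imports "HOL-Analysis.Analysis"
begin

section \<open>Holomorphic functions on the polydisc\<close>

text \<open>
  The dimension \<open>d\<close> is the cardinality of the index type \<open>'d\<close>.  The type is linearly ordered so that
  it is canonically \<open>{1,\<dots>,d}\<close>; in particular \<open>Min UNIV\<close> stands for the index \<open>1\<close>.
  Functions on the polydisc are represented by total functions whose values outside the
  polydisc are irrelevant.
\<close>

definition polydisc :: "(complex ^ 'd) set" where
  "polydisc = {z. \<forall>j. norm (z $ j) < 1}"

definition holomorphic_polydisc :: "(complex ^ 'd \<Rightarrow> complex) \<Rightarrow> bool" where
  "holomorphic_polydisc h \<longleftrightarrow>
     (\<forall>z\<in>polydisc. \<exists>L. (h has_derivative L) (at z) \<and> (\<forall>c v. L (c *s v) = c * L v))"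

definition hol_class :: "(complex ^ 'd \<Rightarrow> complex) set" where
  "hol_class = {h. holomorphic_polydisc h \<and> (\<forall>z\<in>polydisc. norm (h z) \<le> 1)}"

text \<open>The topology of uniform convergence on compact subsets of the polydisc.\<close>

definition hol_nbhd ::
  "(complex ^ 'd \<Rightarrow> complex) \<Rightarrow> (complex ^ 'd) set \<Rightarrow> real \<Rightarrow> (complex ^ 'd \<Rightarrow> complex) set" where
  "hol_nbhd h K e = {g \<in> hol_class. \<forall>z\<in>K. dist (g z) (h z) < e}"

definition hol_topology :: "(complex ^ 'd \<Rightarrow> complex) topology" where
  "hol_topology = topology (\<lambda>U. U \<subseteq> hol_class \<and>
     (\<forall>h\<in>U. \<exists>K e. compact K \<and> K \<subseteq> polydisc \<and> 0 < e \<and> hol_nbhd h K e \<subseteq> U))"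

lemma openin_hol_topology:
  fixes U :: "(complex ^ 'd \<Rightarrow> complex) set"
  shows "openin hol_topology U \<longleftrightarrow> U \<subseteq> hol_class \<and>
     (\<forall>h\<in>U. \<exists>K e. compact K \<and> K \<subseteq> polydisc \<and> 0 < e \<and> hol_nbhd h K e \<subseteq> U)"
proof -
  let ?P = "\<lambda>U :: (complex ^ 'd \<Rightarrow> complex) set. U \<subseteq> hol_class \<and>
     (\<forall>h\<in>U. \<exists>K e. compact K \<and> K \<subseteq> polydisc \<and> 0 < e \<and> hol_nbhd h K e \<subseteq> U)"
  have "istopology ?P"
    unfolding istopology_def
  proof (intro conjI allI impI)
    fix S T assume S: "?P S" and T: "?P T"
    show "S \<inter> T \<subseteq> hol_class" using S by blast
    show "\<forall>h\<in>S \<inter> T. \<exists>K e. compact K \<and> K \<subseteq> polydisc \<and> 0 < e \<and> hol_nbhd h K e \<subseteq> S \<inter> T"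
    proof
      fix h assume h: "h \<in> S \<inter> T"
      obtain K1 e1 where 1: "compact K1" "K1 \<subseteq> polydisc" "0 < e1" "hol_nbhd h K1 e1 \<subseteq> S"
        using S h by blast
      obtain K2 e2 where 2: "compact K2" "K2 \<subseteq> polydisc" "0 < e2" "hol_nbhd h K2 e2 \<subseteq> T"
        using T h by blast
      have "hol_nbhd h (K1 \<union> K2) (min e1 e2) \<subseteq> S \<inter> T"
        using 1(4) 2(4) by (auto simp: hol_nbhd_def)
      then show "\<exists>K e. compact K \<and> K \<subseteq> polydisc \<and> 0 < e \<and> hol_nbhd h K e \<subseteq> S \<inter> T"
        using 1 2 by (intro exI[of _ "K1 \<union> K2"] exI[of _ "min e1 e2"]) auto
    qed
  next
    fix \<K> assume *: "\<forall>K\<in>\<K>. ?P K"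
    show "\<Union>\<K> \<subseteq> hol_class" using * by blast
    show "\<forall>h\<in>\<Union>\<K>. \<exists>K e. compact K \<and> K \<subseteq> polydisc \<and> 0 < e \<and> hol_nbhd h K e \<subseteq> \<Union>\<K>"
    proof
      fix h assume "h \<in> \<Union>\<K>"
      then obtain S where S: "S \<in> \<K>" "h \<in> S" by blast
      have "\<exists>K e. compact K \<and> K \<subseteq> polydisc \<and> 0 < e \<and> hol_nbhd h K e \<subseteq> S"
        using bspec[OF conjunct2[OF bspec[OF * S(1)]] S(2)] .
      then obtain K e where K: "compact K" "K \<subseteq> polydisc" "0 < e" "hol_nbhd h K e \<subseteq> S"
        by (elim exE conjE)
      have "hol_nbhd h K e \<subseteq> \<Union>\<K>"
        using K(4) S(1) by (rule order_trans[OF _ Union_upper])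
      with K(1-3) show "\<exists>K e. compact K \<and> K \<subseteq> polydisc \<and> 0 < e \<and> hol_nbhd h K e \<subseteq> \<Union>\<K>"
        by (intro exI[of _ K] exI[of _ e] conjI)
    qed
  qed
  then show ?thesis
    unfolding hol_topology_def by (simp add: topology_inverse')
qed

lemma topspace_hol_topology:
  "topspace hol_topology = (hol_class :: (complex ^ 'd \<Rightarrow> complex) set)"
proof
  show "topspace hol_topology \<subseteq> (hol_class :: (complex ^ 'd \<Rightarrow> complex) set)"
    using openin_topspace[of hol_topology] unfolding openin_hol_topology by (rule conjunct1)
  have "openin hol_topology (hol_class :: (complex ^ 'd \<Rightarrow> complex) set)"
    unfolding openin_hol_topology
  proof (intro conjI ballI)
    fix h :: "complex ^ 'd \<Rightarrow> complex"
    show "\<exists>K e. compact K \<and> K \<subseteq> polydisc \<and> 0 < e \<and> hol_nbhd h K e \<subseteq> hol_class"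
      by (rule exI[of _ "{}"], rule exI[of _ 1]) (auto simp: hol_nbhd_def)
  qed simp
  then show "(hol_class :: (complex ^ 'd \<Rightarrow> complex) set) \<subseteq> topspace hol_topology"
    by (rule openin_subset)
qed

lemma closure_of_hol_topology:
  "hol_topology closure_of S = {h \<in> hol_class.
     \<forall>K e. compact K \<and> K \<subseteq> polydisc \<and> 0 < e \<longrightarrow> hol_nbhd h K e \<inter> S \<noteq> {}}" (is "?L = ?R")
proof (intro equalityI subsetI)
  fix h assume h: "h \<in> ?L"
  then have hH: "h \<in> hol_class"
    by (simp add: in_closure_of topspace_hol_topology)
  moreover have "hol_nbhd h K e \<inter> S \<noteq> {}" if K: "compact K" "K \<subseteq> polydisc" "0 < e" for K e
  proof -
    define U where "U = {g \<in> hol_class. \<exists>e'<e. \<forall>z\<in>K. dist (g z) (h z) \<le> e'}"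
    have "openin hol_topology U"
      unfolding openin_hol_topology
    proof (intro conjI ballI)
      fix g assume "g \<in> U"
      then obtain e' where e': "e' < e" "\<And>z. z \<in> K \<Longrightarrow> dist (g z) (h z) \<le> e'"
        unfolding U_def by (elim CollectE conjE exE) blast
      have "hol_nbhd g K ((e - e') / 2) \<subseteq> U"
      proof
        fix k assume k: "k \<in> hol_nbhd g K ((e - e') / 2)"
        have "dist (k z) (h z) \<le> (e + e') / 2" if "z \<in> K" for z
        proof -
          have "dist (k z) (g z) < (e - e') / 2" using k that by (auto simp: hol_nbhd_def)
          then show ?thesis
            using e'(2)[OF that] dist_triangle[of "k z" "h z" "g z"] by (simp add: field_simps)
        qed
        moreover have "(e + e') / 2 < e" using e' by simp
        moreover have "k \<in> hol_class" using k by (simp add: hol_nbhd_def)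
        ultimately show "k \<in> U" unfolding U_def by (intro CollectI conjI exI[of _ "(e + e') / 2"]) auto
      qed
      then show "\<exists>K e. compact K \<and> K \<subseteq> polydisc \<and> 0 < e \<and> hol_nbhd g K e \<subseteq> U"
        using K e'(1) by (intro exI[of _ K] exI[of _ "(e - e') / 2"]) auto
    qed (auto simp: U_def)
    moreover have "h \<in> U"
      using hH K(3) unfolding U_def by (auto intro: exI[of _ 0])
    ultimately obtain g where "g \<in> S" "g \<in> U"
      using h by (auto simp: in_closure_of)
    then show ?thesis by (force simp: U_def hol_nbhd_def)
  qed
  ultimately show "h \<in> ?R" by simp
next
  fix h assume h: "h \<in> ?R"
  show "h \<in> ?L"
    unfolding in_closure_of topspace_hol_topology
  proof (intro conjI allI impI)
    fix T assume T: "h \<in> T \<and> openin hol_topology T"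
    then have "\<exists>K e. compact K \<and> K \<subseteq> polydisc \<and> 0 < e \<and> hol_nbhd h K e \<subseteq> T"
      unfolding openin_hol_topology by simp
    then obtain K e where K: "compact K" "K \<subseteq> polydisc" "0 < e" "hol_nbhd h K e \<subseteq> T"
      by (elim exE conjE)
    then have "hol_nbhd h K e \<inter> S \<noteq> {}" using h by simp
    then show "\<exists>y. y \<in> S \<and> y \<in> T" using K(4) by auto
  next
    show "h \<in> hol_class" using h by simp
  qed
qed

section \<open>Schur functions and their continued fraction expansions\<close>

definition op_m :: "'d \<Rightarrow> (complex ^ 'd \<Rightarrow> complex) \<Rightarrow> complex ^ 'd \<Rightarrow> complex" where
  "op_m j h = (\<lambda>z. z $ j * h z)"

text \<open>Only parameters \<open>r\<close> with \<open>norm r \<le> 1\<close> matter; the second branch is the case \<open>norm r = 1\<close>.\<close>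

definition op_g :: "complex \<Rightarrow> (complex ^ 'd \<Rightarrow> complex) \<Rightarrow> complex ^ 'd \<Rightarrow> complex" where
  "op_g r h = (if norm r < 1 then (\<lambda>z. (h z + r) / (1 + cnj r * h z)) else (\<lambda>z. r))"

definition schur_generators :: "(complex ^ 'd \<Rightarrow> complex) set" where
  "schur_generators =
     {foldr (\<lambda>(r, j) h. op_g r (op_m j h)) w (\<lambda>z. 0) | w.
        w \<noteq> [] \<and> (\<forall>(r, j) \<in> set w. norm r < 1)}"

definition schur_class :: "(complex ^ 'd \<Rightarrow> complex) set" where
  "schur_class = hol_topology closure_of schur_generators"

text \<open>
  \<open>\<nu>\<close> is an allocation map indexed by the positive integers: the value \<open>\<nu> 0\<close> is never used.
\<close>

definition schur_expansion ::
  "(complex ^ 'd :: {finite, linorder} \<Rightarrow> complex) \<Rightarrow> (nat \<Rightarrow> complex) \<Rightarrow> (nat \<Rightarrow> 'd) \<Rightarrow> bool" where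
  "schur_expansion f r \<nu> \<longleftrightarrow>
     (\<exists>h.
        h 0 = f \<and>
        (\<forall>n. h n \<in> schur_class \<and>
             r n = h n 0 \<and>
             (\<forall>z\<in>polydisc. h n z = op_g (r n) (op_m (\<nu> (Suc n)) (h (Suc n))) z) \<and>
             (h n constant_on polydisc \<longrightarrow>
                \<nu> (Suc n) = Min UNIV \<and> (\<forall>z\<in>polydisc. h (Suc n) z = 0))))"

definition schur_convergent ::
  "(nat \<Rightarrow> complex) \<Rightarrow> (nat \<Rightarrow> 'd) \<Rightarrow> nat \<Rightarrow> complex ^ 'd \<Rightarrow> complex" where
  "schur_convergent r \<nu> n =
     foldr (\<lambda>k h. op_g (r k) (op_m (\<nu> (Suc k)) h)) [0..<n] (op_g (r n) (\<lambda>z. 0))"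

section \<open>Scattering polynomials\<close>

text \<open>The Wirtinger derivatives \<open>(\<partial>\<^sub>x - \<i>\<partial>\<^sub>y)/2\<close> and \<open>(\<partial>\<^sub>x + \<i>\<partial>\<^sub>y)/2\<close>.\<close>

definition d_z :: "(complex \<Rightarrow> complex) \<Rightarrow> complex \<Rightarrow> complex" where
  "d_z f z = (frechet_derivative f (at z) 1 - \<i> * frechet_derivative f (at z) \<i>) / 2"

definition d_zbar :: "(complex \<Rightarrow> complex) \<Rightarrow> complex \<Rightarrow> complex" where
  "d_zbar f z = (frechet_derivative f (at z) 1 + \<i> * frechet_derivative f (at z) \<i>) / 2"

definition scattering_poly :: "nat \<Rightarrow> nat \<Rightarrow> complex \<Rightarrow> complex" where
  "scattering_poly p q z =
     (if q = 0 then z ^ p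
      else if p = 0 then 0
      else (-1) ^ p / (of_nat q * fact (p + q - 1)) * (1 - z * cnj z) *
           (d_zbar ^^ p) ((d_z ^^ q) (\<lambda>w. (1 - w * cnj w) ^ (p + q - 1))) z)"

lemma wirtinger_eqI:
  assumes "(f has_derivative (\<lambda>h. a * h + b * cnj h)) (at z)"
  shows "d_z f z = a" "d_zbar f z = b"
proof -
  have "frechet_derivative f (at z) = (\<lambda>h. a * h + b * cnj h)"
    using frechet_derivative_at[OF assms] by simp
  then show "d_z f z = a" "d_zbar f z = b"
    by (simp_all add: d_z_def d_zbar_def algebra_simps)
qed

lemma one_minus_norm_power_has_derivative:
  "((\<lambda>w. (1 - w * cnj w) ^ n) has_derivative
     (\<lambda>h. (of_nat n * (- cnj z) * (1 - z * cnj z) ^ (n - 1)) * h +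
          (of_nat n * (- z) * (1 - z * cnj z) ^ (n - 1)) * cnj h)) (at z)"
  by (rule derivative_eq_intros refl | simp add: algebra_simps)+

lemma cnj_power_has_derivative:
  "((\<lambda>w. cnj w ^ n) has_derivative
     (\<lambda>h. 0 * h + (of_nat n * cnj z ^ (n - 1)) * cnj h)) (at z)"
  by (rule derivative_eq_intros refl | simp add: algebra_simps)+

lemma power_wirtinger_derivative:
  "((\<lambda>w. (- w) ^ n) has_derivative
     (\<lambda>h. (of_nat n * - ((- z) ^ (n - 1))) * h + 0 * cnj h)) (at (z :: complex))"
  by (rule derivative_eq_intros refl | simp add: algebra_simps)+

lemma cmult_wirtinger_derivative:
  assumes "(f has_derivative (\<lambda>h. a * h + b * cnj h)) (at z)"
  shows "((\<lambda>w. c * f w) has_derivative (\<lambda>h. (c * a) * h + (c * b) * cnj h)) (at z)"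
  by (rule has_derivative_eq_rhs[OF has_derivative_mult_right[OF assms]])
     (simp add: fun_eq_iff distrib_left mult.assoc)

lemma mult_wirtinger_derivative:
  assumes "(f has_derivative (\<lambda>h. a * h + b * cnj h)) (at z)"
    and "(g has_derivative (\<lambda>h. c * h + d * cnj h)) (at z)"
  shows "((\<lambda>w. f w * g w) has_derivative
           (\<lambda>h. (f z * c + a * g z) * h + (f z * d + b * g z) * cnj h)) (at z)"
  by (rule has_derivative_eq_rhs[OF has_derivative_mult[OF assms]])
     (simp add: fun_eq_iff algebra_simps)

lemma choose_fact_step:
  "of_nat (n choose k) * fact k * of_nat (n - k) =
     (of_nat (n choose Suc k) * fact (Suc k) :: 'a :: {comm_semiring_1, semiring_char_0})"
proof -
  have "(n choose k) * (n - k) = (n choose Suc k) * Suc k"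
    using binomial_absorb_comp[of n k] binomial_absorption[of k n] by (simp only: mult.commute)
  then have "of_nat ((n choose k) * (n - k)) = (of_nat ((n choose Suc k) * Suc k) :: 'a)"
    by (rule arg_cong)
  then show ?thesis by (simp only: fact_Suc of_nat_mult mult_ac)
qed

lemma d_z_funpow:
  "(d_z ^^ q) (\<lambda>w. (1 - w * cnj w) ^ n) =
     (\<lambda>z. of_nat (n choose q) * fact q * (- cnj z) ^ q * (1 - z * cnj z) ^ (n - q))"
proof (induction q)
  case (Suc q)
  let ?c = "of_nat (n choose q) * fact q :: complex"
  have "d_z (\<lambda>w. ?c * (- cnj w) ^ q * (1 - w * cnj w) ^ (n - q)) z =
      (?c * of_nat (n - q)) * (- cnj z) ^ Suc q * (1 - z * cnj z) ^ (n - Suc q)" for z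
  proof -
    have m: "(- cnj w) ^ k = (-1) ^ k * cnj w ^ k" for w k
      by (rule power_minus)
    have eq: "(\<lambda>w. ?c * (- cnj w) ^ q * (1 - w * cnj w) ^ (n - q)) =
        (\<lambda>w. (?c * (-1) ^ q) * (cnj w ^ q * (1 - w * cnj w) ^ (n - q)))"
      by (simp only: m mult_ac)
    have "d_z (\<lambda>w. ?c * (- cnj w) ^ q * (1 - w * cnj w) ^ (n - q)) z =
        (?c * (-1) ^ q) * (cnj z ^ q *
          (of_nat (n - q) * (- cnj z) * (1 - z * cnj z) ^ (n - q - 1)) +
          0 * (1 - z * cnj z) ^ (n - q))"
      unfolding eq
      using wirtinger_eqI(1)[OF cmult_wirtinger_derivative[OF mult_wirtinger_derivative
            [OF cnj_power_has_derivative one_minus_norm_power_has_derivative]]]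
      by simp
    also have "\<dots> = (?c * of_nat (n - q)) * ((-1) ^ q * cnj z ^ q * (- cnj z)) *
        (1 - z * cnj z) ^ (n - q - 1)"
      by (simp only: mult_zero_left add_0_right mult_ac)
    also have "(-1) ^ q * cnj z ^ q * (- cnj z) = (- cnj z) ^ Suc q"
      unfolding m[symmetric] by (rule power_Suc2[symmetric])
    finally show ?thesis by (simp only: diff_Suc_eq_diff_pred diff_diff_left Suc_eq_plus1)
  qed
  then show ?case
    unfolding choose_fact_step funpow.simps o_apply Suc.IH by (rule ext)
qed simp

lemma d_zbar_leibniz:
  assumes U: "\<And>k z. \<exists>a. (U k has_derivative (\<lambda>h. a * h + U (Suc k) z * cnj h)) (at z)"
    and V: "\<And>k z. \<exists>a. (V k has_derivative (\<lambda>h. a * h + V (Suc k) z * cnj h)) (at z)"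
  shows "(d_zbar ^^ m) (\<lambda>z. U 0 z * V 0 z) =
           (\<lambda>z. \<Sum>k\<le>m. of_nat (m choose k) * (U k z * V (m - k) z))"
proof (induction m)
  case (Suc m)
  obtain a where a: "\<And>k z. (U k has_derivative (\<lambda>h. a k z * h + U (Suc k) z * cnj h)) (at z)"
    using U by metis
  obtain b where b: "\<And>k z. (V k has_derivative (\<lambda>h. b k z * h + V (Suc k) z * cnj h)) (at z)"
    using V by metis
  have "d_zbar (\<lambda>z. \<Sum>k\<le>m. of_nat (m choose k) * (U k z * V (m - k) z)) z =
     (\<Sum>k\<le>Suc m. of_nat (Suc m choose k) * (U k z * V (Suc m - k) z))" for z
  proof -
    have "d_zbar (\<lambda>z. \<Sum>k\<le>m. of_nat (m choose k) * (U k z * V (m - k) z)) z =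
       (\<Sum>k\<le>m. of_nat (m choose k) *
            (U (Suc k) z * V (m - k) z + U k z * V (Suc (m - k)) z))"
    proof (rule wirtinger_eqI(2), rule has_derivative_eq_rhs)
      show "((\<lambda>w. \<Sum>k\<le>m. of_nat (m choose k) * (U k w * V (m - k) w)) has_derivative
         (\<lambda>h. \<Sum>k\<le>m. of_nat (m choose k) *
            (U k z * (b (m - k) z * h + V (Suc (m - k)) z * cnj h) +
             (a k z * h + U (Suc k) z * cnj h) * V (m - k) z))) (at z)"
        by (intro has_derivative_sum has_derivative_mult_right has_derivative_mult a b)
      show "(\<lambda>h. \<Sum>k\<le>m. of_nat (m choose k) *
            (U k z * (b (m - k) z * h + V (Suc (m - k)) z * cnj h) +
             (a k z * h + U (Suc k) z * cnj h) * V (m - k) z)) =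
         (\<lambda>h. (\<Sum>k\<le>m. of_nat (m choose k) * (U k z * b (m - k) z + a k z * V (m - k) z)) * h +
            (\<Sum>k\<le>m. of_nat (m choose k) *
              (U (Suc k) z * V (m - k) z + U k z * V (Suc (m - k)) z)) * cnj h)"
        by (rule ext, simp only: sum_distrib_right sum.distrib[symmetric], rule sum.cong[OF refl],
            simp add: algebra_simps)
    qed
    also have "\<dots> = (\<Sum>k\<le>m. of_nat (m choose k) * (U (Suc k) z * V (m - k) z)) +
        (\<Sum>k\<le>Suc m. of_nat (m choose k) * (U k z * V (Suc m - k) z))"
      by (simp add: sum.distrib distrib_left Suc_diff_le cong: sum.cong_simp)
    also have "\<dots> = (\<Sum>k\<le>Suc m. of_nat (Suc m choose k) * (U k z * V (Suc m - k) z))"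
      unfolding sum.atMost_Suc_shift by (simp add: sum.distrib distrib_right)
    finally show ?thesis .
  qed
  then show ?case unfolding funpow.simps o_apply Suc.IH by (rule ext)
qed simp

lemma choose_mult_fact:
  assumes "k \<le> n"
  shows "of_nat (n choose k) * fact k = (fact n / fact (n - k) :: complex)"
  using assms by (simp add: binomial_fact)

lemma scattering_poly_eq_sum:
  assumes "p \<ge> 1" "q \<ge> 1"
  shows "scattering_poly p q z =
    (\<Sum>j = 1..min p q. of_nat (p choose j) * of_nat ((q - 1) choose (j - 1)) *
       z ^ (p - j) * (- cnj z) ^ (q - j) * (1 - z * cnj z) ^ j)"
proof -
  define n where "n = p + q - 1"
  define C where "C = (of_nat (n choose q) * fact q :: complex)"
  define U where
    "U k w = C * (-1) ^ q * (of_nat (q choose k) * fact k) * cnj w ^ (q - k)" for k w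
  define V where
    "V k w = of_nat ((p - 1) choose k) * fact k * (- w) ^ k * (1 - w * cnj w) ^ (p - 1 - k)" for k w
  have UV: "(d_z ^^ q) (\<lambda>w. (1 - w * cnj w) ^ n) = (\<lambda>w. U 0 w * V 0 w)"
  proof -
    have "n - q = p - 1" using assms by (simp add: n_def)
    then show ?thesis
      by (simp add: d_z_funpow U_def V_def C_def fun_eq_iff power_minus[of "cnj _"])
  qed
  have "(U k has_derivative (\<lambda>h. 0 * h + U (Suc k) w * cnj h)) (at w)" for k w
  proof -
    have "(U k has_derivative (\<lambda>h. C * (-1) ^ q * (of_nat (q choose k) * fact k) *
        (0 * h + (of_nat (q - k) * cnj w ^ (q - k - 1)) * cnj h))) (at w)"
      unfolding U_def by (intro has_derivative_mult_right cnj_power_has_derivative)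
    moreover have "U (Suc k) w =
        C * (-1) ^ q * (of_nat (q choose k) * fact k * of_nat (q - k)) * cnj w ^ (q - k - 1)"
      unfolding choose_fact_step by (simp add: U_def)
    ultimately show ?thesis by (simp add: algebra_simps)
  qed
  then have U': "\<exists>a. (U k has_derivative (\<lambda>h. a * h + U (Suc k) w * cnj h)) (at w)" for k w
    by blast
  have V': "\<exists>a. (V k has_derivative (\<lambda>h. a * h + V (Suc k) w * cnj h)) (at w)" for k w
  proof -
    let ?c = "of_nat ((p - 1) choose k) * fact k :: complex"
    let ?m = "p - 1 - k"
    have "V (Suc k) w = (?c * of_nat ?m) * (- w) ^ Suc k * (1 - w * cnj w) ^ (?m - 1)"
      unfolding choose_fact_step by (simp add: V_def)
    then have *: "V (Suc k) w =
        ?c * (- w) ^ k * (of_nat ?m * (- w) * (1 - w * cnj w) ^ (?m - 1))"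
      by simp
    have **: "V k = (\<lambda>w. ?c * ((- w) ^ k * (1 - w * cnj w) ^ ?m))"
      by (simp add: V_def fun_eq_iff mult.assoc)
    have "\<exists>a. (V k has_derivative (\<lambda>h. a * h + (?c * ((- w) ^ k *
        (of_nat ?m * (- w) * (1 - w * cnj w) ^ (?m - 1)) + 0 * (1 - w * cnj w) ^ ?m)) * cnj h)) (at w)"
      unfolding **
      by (rule exI, rule cmult_wirtinger_derivative[OF mult_wirtinger_derivative
            [OF power_wirtinger_derivative one_minus_norm_power_has_derivative]])
    then show ?thesis unfolding * by (simp only: mult_zero_left add_0_right mult.assoc)
  qed
  let ?A = "(-1) ^ p / (of_nat q * fact n) * (1 - z * cnj z)"
  let ?t = "\<lambda>k. of_nat (p choose k) * (U k z * V (p - k) z)"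
  have "scattering_poly p q z =
      ?A * (d_zbar ^^ p) ((d_z ^^ q) (\<lambda>w. (1 - w * cnj w) ^ n)) z"
    using assms unfolding scattering_poly_def n_def by simp
  also have "\<dots> = ?A * (\<Sum>k\<le>p. ?t k)"
    unfolding UV d_zbar_leibniz[of U V p, OF U' V'] ..
  also have "(\<Sum>k\<le>p. ?t k) = (\<Sum>k = 1..min p q. ?t k)"
  proof (rule sum.mono_neutral_right)
    show "\<forall>k\<in>{..p} - {1..min p q}. ?t k = 0"
    proof
      fix k assume "k \<in> {..p} - {1..min p q}"
      then consider "k = 0" | "k > q" by force
      then show "?t k = 0"
        by cases (use assms in \<open>auto simp: U_def V_def\<close>)
    qed
  qed auto
  also have "?A * \<dots> = (\<Sum>k = 1..min p q. ?A * ?t k)"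
    by (rule sum_distrib_left)
  also have "\<dots> = (\<Sum>j = 1..min p q. of_nat (p choose j) * of_nat ((q - 1) choose (j - 1)) *
       z ^ (p - j) * (- cnj z) ^ (q - j) * (1 - z * cnj z) ^ j)"
  proof (rule sum.cong[OF refl])
    fix k assume "k \<in> {1..min p q}"
    then have k: "1 \<le> k" "k \<le> p" "k \<le> q" by auto
    then obtain i where i: "k = Suc i" by (cases k) auto
    obtain s where s: "p = k + s" using k(2) le_Suc_ex by blast
    obtain t where t: "q = k + t" using k(3) le_Suc_ex by blast
    have C: "C = fact n / fact (p - 1)"
      unfolding C_def using assms by (subst choose_mult_fact) (auto simp: n_def)
    have Uk: "U k z = fact n / fact (p - 1) * (-1) ^ q * (fact q / fact t) * cnj z ^ t"
      unfolding U_def C using k by (subst choose_mult_fact) (auto simp: t)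
    have Vk: "V (p - k) z = fact (p - 1) / fact i * (- z) ^ s * (1 - z * cnj z) ^ i"
      unfolding V_def using k by (subst choose_mult_fact) (auto simp: s i)
    have B: "of_nat ((q - 1) choose (k - 1)) = (fact (q - 1) / (fact i * fact t) :: complex)"
      using k by (subst binomial_fact) (auto simp: i t)
    have fq: "(fact q :: complex) = of_nat q * fact (q - 1)"
      using assms by (simp add: fact_reduce)
    have q0: "(of_nat q :: complex) \<noteq> 0" using assms by simp
    have sgn: "(-1) ^ p * (-1) ^ q * (-z) ^ s * cnj z ^ t = z ^ s * (- cnj z) ^ t"
    proof -
      have "p + q + s = 2 * (k + s) + t" by (simp add: s t)
      then have "(-1) ^ (p + q + s) = ((-1) ^ t :: complex)"
        by (simp only: power_add power_mult) simp
      then have e: "(-1) ^ p * (-1) ^ q * (-1) ^ s = ((-1) ^ t :: complex)"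
        by (simp only: power_add)
      have "(-1) ^ p * (-1) ^ q * (-z) ^ s * cnj z ^ t =
          ((-1) ^ p * (-1) ^ q * (-1) ^ s) * (z ^ s * cnj z ^ t)"
        by (simp only: power_minus[of z] mult.assoc)
      also have "\<dots> = z ^ s * (- cnj z) ^ t"
        unfolding e power_minus[of "cnj z" t] by (simp only: mult_ac)
      finally show ?thesis .
    qed
    have "?A * ?t k = of_nat (p choose k) * (fact (q - 1) / (fact i * fact t)) *
        ((-1) ^ p * (-1) ^ q * (-z) ^ s * cnj z ^ t) * (1 - z * cnj z) ^ k"
      unfolding Uk Vk fq using q0 by (simp add: i field_simps)
    also have "\<dots> = of_nat (p choose k) * of_nat ((q - 1) choose (k - 1)) *
       z ^ (p - k) * (- cnj z) ^ (q - k) * (1 - z * cnj z) ^ k"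
      unfolding B sgn using s t by simp
    finally show "?A * ?t k = of_nat (p choose k) * of_nat ((q - 1) choose (k - 1)) *
       z ^ (p - k) * (- cnj z) ^ (q - k) * (1 - z * cnj z) ^ k" .
  qed
  finally show ?thesis .
qed

section \<open>Scattering weights\<close>

text \<open>
  Multi-indices are indexed by the positive integers; this is encoded by \<open>\<alpha> 0 = 0\<close>.
\<close>

definition supp :: "(nat \<Rightarrow> nat) \<Rightarrow> nat set" where
  "supp \<alpha> = {j. \<alpha> j \<noteq> 0}"

definition multi_indices :: "(nat \<Rightarrow> nat) set" where
  "multi_indices = {\<alpha>. \<alpha> 0 = 0 \<and> finite (supp \<alpha>)}"

definition multi_degree :: "(nat \<Rightarrow> nat) \<Rightarrow> nat" where
  "multi_degree \<alpha> = (\<Sum>j\<in>supp \<alpha>. \<alpha> j)"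

definition scattering_weight :: "(nat \<Rightarrow> nat) \<Rightarrow> (nat \<Rightarrow> complex) \<Rightarrow> complex" where
  "scattering_weight \<alpha> r =
     (let n = (if supp \<alpha> = {} then 0 else Max (supp \<alpha>))
      in scattering_poly 1 (\<alpha> 1) (r 0) *
         (\<Prod>j = 1..n. scattering_poly (\<alpha> j) (\<alpha> (Suc j)) (r j)))"

definition alloc_monomial :: "(nat \<Rightarrow> 'd) \<Rightarrow> (nat \<Rightarrow> nat) \<Rightarrow> complex ^ 'd \<Rightarrow> complex" where
  "alloc_monomial \<nu> \<alpha> z = (\<Prod>j\<in>supp \<alpha>. (z $ \<nu> j) ^ \<alpha> j)"

text \<open>
  There are infinitely many multi-indices of degree at most \<open>m\<close>, so the partial sum
  is taken over those with nonzero weight.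
\<close>

definition active_indices :: "(nat \<Rightarrow> complex) \<Rightarrow> nat \<Rightarrow> (nat \<Rightarrow> nat) set" where
  "active_indices r m =
     {\<alpha> \<in> multi_indices. multi_degree \<alpha> \<le> m \<and> scattering_weight \<alpha> r \<noteq> 0}"

definition scattering_partial_sum ::
  "(nat \<Rightarrow> complex) \<Rightarrow> (nat \<Rightarrow> 'd) \<Rightarrow> nat \<Rightarrow> complex ^ 'd \<Rightarrow> complex" where
  "scattering_partial_sum r \<nu> m z =
     (\<Sum>\<alpha>\<in>active_indices r m. scattering_weight \<alpha> r * alloc_monomial \<nu> \<alpha> z)"

end

theory Submission
  imports Defs "HOL-Complex_Analysis.Complex_Analysis"
begin

text \<open>
  The convergents and the series are treated by two independent arguments, both of which look at one
  point \<open>z\<close> of the polydisc at a time.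

  For the convergents, the values \<open>h\<^sub>k(z)\<close> of the functions produced by the continued fraction algorithm and
  the tails of the \<open>n\<close>th convergent at \<open>z\<close> satisfy the same recursion for \<open>k < n\<close>, and they all lie in
  the closed unit disc.  The maps \<open>w \<mapsto> (w + r) / (1 + cnj r w)\<close> are isometries for the
  pseudohyperbolic distance \<open>|a - b| / |1 - cnj a b|\<close>, while multiplication by a number of modulus at
  most \<open>\<rho> < 1\<close> contracts it by the factor \<open>2\<rho> / (1 + \<rho>\<^sup>2) < 1\<close> (\<open>pseudohyperbolic_le_mult\<close>).  Hence
  \<open>f\<^sub>n(z)\<close> approaches \<open>f(z)\<close> geometrically, at a rate that depends on \<open>\<rho>\<close> only, and \<open>\<rho>\<close> can be chosen
  uniformly on a compact set.

  For the series, the scattering polynomials are the Taylor coefficients of powers of disc automorphisms: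
  \<open>\<phi>\<^sup>(\<^sup>p\<^sup>,\<^sup>q\<^sup>)(r)\<close> is the coefficient of \<open>w\<^sup>q\<close> in \<open>((w + r) / (1 + cnj r w))\<^sup>p\<close>
  (\<open>fps_nth_blaschke_power\<close>).  Consequently, as formal power series along each complex line through
  the origin, \<open>h\<^sub>n\<^sup>p = \<Sum>\<^sub>q \<phi>\<^sup>(\<^sup>p\<^sup>,\<^sup>q\<^sup>)(r\<^sub>n) z\<^sub>j\<^sup>q h\<^sub>n\<^sub>+\<^sub>1\<^sup>q\<close> where \<open>j\<close> is the allocated variable.
  The factor \<open>z\<^sub>j\<^sup>q\<close> uses up degree \<open>q\<close>, so iterating from \<open>h\<^sub>0\<^sup>1 = f\<close> terminates in each degree \<open>k\<close> and
  writes the homogeneous part of degree \<open>k\<close> as a sum over the compositions of \<open>k\<close>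
  (\<open>slice_fps_power_eq_sum_compositions\<close>).  Compositions are exactly the multi-indices whose
  support is an initial segment, and all others have weight zero because \<open>\<phi>\<^sup>(\<^sup>0\<^sup>,\<^sup>q\<^sup>) = 0\<close> for \<open>q > 0\<close>.
  So the partial sums of the series are the Taylor sections of \<open>f\<close> along lines
  (\<open>scattering_partial_sum_eq_taylor\<close>), which converge uniformly on compact sets by the Cauchy
  estimates.
\<close>

(* Keeps the dollar sign for the components of a vector. *)
no_notation fps_nth (infixl \<open>$\<close> 75)

section \<open>Scattering polynomials as Taylor coefficients\<close>

definition blaschke_fps :: "complex \<Rightarrow> complex fps" where
  "blaschke_fps r = (fps_X + fps_const r) * inverse (1 + fps_const (cnj r) * fps_X)"

lemma fps_nth_power_X_over_linear:
  fixes c :: complex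
  assumes "j \<ge> 1"
  shows "fps_nth ((fps_X * inverse (1 + fps_const c * fps_X)) ^ j) q =
           (if q < j then 0 else of_nat ((q - 1) choose (j - 1)) * (- c) ^ (q - j))"
proof -
  have "inverse (1 + fps_const c * fps_X) ^ j = inverse ((1 - fps_const (- c) * fps_X) ^ j)"
    by (simp add: fps_inverse_power flip: fps_const_neg)
  also have "\<dots> = Abs_fps (\<lambda>k. of_nat ((j + k - 1) choose k) * (- c) ^ k)"
    using assms by (subst one_minus_const_fps_X_neg_power') auto
  finally have inv: "inverse (1 + fps_const c * fps_X) ^ j = \<dots>" .
  have "(q - 1) choose (q - j) = (q - 1) choose (j - 1)" if "j \<le> q"
    using binomial_symmetric[of "j - 1" "q - 1"] that assms by simp
  then show ?thesis
    using assms by (simp add: power_mult_distrib inv fps_X_power_mult_nth)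
qed

text \<open>
  Splitting off the constant term lets a power be expanded by the binomial theorem; this is where
  the powers of \<open>1 - r * cnj r\<close> in the scattering polynomials come from.
\<close>

lemma blaschke_fps_eq:
  "blaschke_fps r = fps_const (1 - r * cnj r) * (fps_X * inverse (1 + fps_const (cnj r) * fps_X))
     + fps_const r"
proof -
  let ?D = "1 + fps_const (cnj r) * fps_X"
  have D: "?D * inverse ?D = 1"
    by (subst mult.commute, rule inverse_mult_eq_1) simp
  have N: "fps_X + fps_const r = fps_const (1 - r * cnj r) * fps_X + fps_const r * ?D"
    by (simp add: algebra_simps flip: fps_const_sub fps_const_mult)
  show ?thesis
    unfolding blaschke_fps_def N
    by (simp only: distrib_right[of "_ * _" "_ * _" "inverse ?D"] mult.assoc D mult_1_right)
qed

text \<open>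
  The fact behind the whole series expansion.  For \<open>norm r = 1\<close> numerator and denominator cancel to
  the constant series \<open>r\<close>, so the recursion for the Taylor coefficients has the same form for interior
  and boundary parameters.
\<close>

lemma fps_nth_blaschke_power: "fps_nth (blaschke_fps r ^ p) q = scattering_poly p q r"
proof -
  consider "q = 0" | "q \<ge> 1" "p = 0" | "q \<ge> 1" "p \<ge> 1" by linarith
  then show ?thesis
  proof cases
    case 1
    then show ?thesis by (simp add: scattering_poly_def blaschke_fps_def fps_power_zeroth)
  next
    case 2
    then show ?thesis by (simp add: scattering_poly_def)
  next
    case 3
    define Y where "Y = fps_X * inverse (1 + fps_const (cnj r) * fps_X)"
    note nth_Y = fps_nth_power_X_over_linear[of _ "cnj r" q, folded Y_def]
    let ?t = "\<lambda>j. of_nat (p choose j) * (1 - r * cnj r) ^ j * r ^ (p - j) * fps_nth (Y ^ j) q"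
    have "fps_nth (blaschke_fps r ^ p) q = (\<Sum>j\<le>p. ?t j)"
      unfolding blaschke_fps_eq Y_def[symmetric] binomial_ring fps_sum_nth
      by (intro sum.cong refl) (simp add: power_mult_distrib fps_of_nat[symmetric] mult_ac del: fps_of_nat)
    also have "\<dots> = (\<Sum>j = 1..min p q. ?t j)"
    proof (rule sum.mono_neutral_right)
      show "\<forall>j\<in>{..p} - {1..min p q}. ?t j = 0"
      proof
        fix j assume "j \<in> {..p} - {1..min p q}"
        then consider "j = 0" | "j \<ge> 1" "q < j" by force
        then show "?t j = 0"
          by cases (use 3 in \<open>simp_all add: nth_Y\<close>)
      qed
    qed auto
    also have "\<dots> = scattering_poly p q r"
      unfolding scattering_poly_eq_sum[OF 3(2,1)]
      by (intro sum.cong refl) (auto simp: nth_Y)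
    finally show ?thesis .
  qed
qed

section \<open>Pseudohyperbolic contraction\<close>

text \<open>
  For \<open>a \<noteq> b\<close> in the open disc this bounds the pseudohyperbolic distance by \<open>c\<close>.  Without the division
  it also makes sense on the boundary, where \<open>1 - cnj a * b\<close> may vanish.
\<close>

definition pseudohyperbolic_le :: "real \<Rightarrow> complex \<Rightarrow> complex \<Rightarrow> bool" where
  "pseudohyperbolic_le c a b \<longleftrightarrow> norm (a - b) \<le> c * norm (1 - cnj a * b)"

text \<open>
  Both sides are compared through the identity
  \<open>1 - t w = (1 + t)/2 (1 - w) + (1 - t)/2 (1 + w)\<close>, whose two summands have a nonnegative real inner
  product \<open>1 - |w|\<^sup>2\<close> up to a positive factor.
\<close>

lemma one_minus_scaled_ge:
  assumes "norm (w :: complex) \<le> 1" "0 \<le> t" "t \<le> 1"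
  shows "(1 + t) / 2 * norm (1 - w) \<le> norm (1 - of_real t * w)"
proof -
  obtain x y where w: "w = Complex x y" by (cases w)
  have xy: "x\<^sup>2 + y\<^sup>2 \<le> 1"
    using assms(1) by (simp add: w cmod_def)
  have "((1 + t) / 2 * norm (1 - w))\<^sup>2 \<le> (norm (1 - of_real t * w))\<^sup>2"
  proof -
    have "(norm (1 - of_real t * w))\<^sup>2 - ((1 + t) / 2 * norm (1 - w))\<^sup>2 =
       (1 - t\<^sup>2) / 2 * (1 - (x\<^sup>2 + y\<^sup>2)) + ((1 - t) / 2)\<^sup>2 * ((1 + x)\<^sup>2 + y\<^sup>2)"
      unfolding power_mult_distrib cmod_power2 w by (simp add: field_simps power2_eq_square)
    also have "\<dots> \<ge> 0"
      using xy assms by (intro add_nonneg_nonneg mult_nonneg_nonneg) (auto simp: power_le_one)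
    finally show ?thesis by simp
  qed
  then show ?thesis by (rule power2_le_imp_le) simp
qed

lemma blaschke_denominator_nonzero:
  assumes "norm (r :: complex) < 1 \<or> norm a < 1" "norm a \<le> 1" "norm r \<le> 1"
  shows "1 + cnj r * a \<noteq> 0"
proof
  assume "1 + cnj r * a = 0"
  then have "cnj r * a = - 1" by (simp add: add_eq_0_iff)
  then have "norm r * norm a = 1"
    by (metis complex_mod_cnj norm_minus_cancel norm_mult norm_one)
  moreover have "norm r * norm a \<le> norm r" "norm r * norm a \<le> norm a"
    using assms by (simp_all add: mult_left_le mult_left_le_one_le)
  ultimately show False using assms(1) by linarith
qed


lemma norm_diff_le_norm_one_minus:
  assumes "norm (a :: complex) \<le> 1" "norm b \<le> 1"
  shows "norm (a - b) \<le> norm (1 - cnj a * b)"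
proof (rule power2_le_imp_le)
  have "complex_of_real ((norm (1 - cnj a * b))\<^sup>2 - (norm (a - b))\<^sup>2) =
      complex_of_real ((1 - (norm a)\<^sup>2) * (1 - (norm b)\<^sup>2))"
    unfolding of_real_diff of_real_mult of_real_1 complex_norm_square by (simp add: algebra_simps)
  then have "(norm (1 - cnj a * b))\<^sup>2 - (norm (a - b))\<^sup>2 = (1 - (norm a)\<^sup>2) * (1 - (norm b)\<^sup>2)"
    unfolding of_real_eq_iff .
  also have "\<dots> \<ge> 0"
    using assms by (intro mult_nonneg_nonneg) (auto simp: power_le_one)
  finally show "(norm (a - b))\<^sup>2 \<le> (norm (1 - cnj a * b))\<^sup>2" by simp
qed simp

lemma norm_blaschke_le_1:
  assumes "norm (a :: complex) \<le> 1" "norm r \<le> 1"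
  shows "norm ((a + r) / (1 + cnj r * a)) \<le> 1"
  using norm_diff_le_norm_one_minus[of r "- a"] assms
  by (simp add: norm_divide divide_le_eq_1 add.commute)

text \<open>
  The bound \<open>norm z\<close> alone would not do as contraction factor, since \<open>1 - |z|\<^sup>2 * w\<close> can be closer to
  \<open>0\<close> than \<open>1 - w\<close>; the loss is controlled by \<open>one_minus_scaled_ge\<close>.
\<close>

lemma pseudohyperbolic_le_mult:
  assumes "pseudohyperbolic_le c a b" "c \<ge> 0" "norm a \<le> 1" "norm b \<le> 1" "norm z \<le> \<rho>" "\<rho> \<le> 1"
  shows "pseudohyperbolic_le (c * (2 * \<rho> / (1 + \<rho>\<^sup>2))) (z * a) (z * b)"
proof -
  let ?s = "norm z" and ?w = "cnj a * b"
  have s: "0 \<le> ?s" "?s \<le> 1" using assms by auto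
  have \<rho>0: "0 \<le> \<rho>" using assms(5) norm_ge_zero order_trans by blast
  have w: "norm ?w \<le> 1"
    using assms by (simp add: norm_mult mult_le_one)
  have D: "1 - cnj (z * a) * (z * b) = 1 - of_real (?s\<^sup>2) * ?w"
    by (simp only: complex_norm_square complex_cnj_mult mult_ac)
  have le: "(1 + ?s\<^sup>2) / 2 * norm (1 - ?w) \<le> norm (1 - of_real (?s\<^sup>2) * ?w)"
    using s w by (intro one_minus_scaled_ge) (auto simp: power_le_one)
  have "?s * (1 + \<rho>\<^sup>2) \<le> \<rho> * (1 + ?s\<^sup>2)"
  proof -
    have "?s * \<rho> \<le> 1" using s assms \<rho>0 by (intro mult_le_one) auto
    \<comment> \<open>\<open>s / (1 + s\<^sup>2)\<close> increases on the unit interval.\<close>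
    then have "0 \<le> (\<rho> - ?s) * (1 - ?s * \<rho>)" using assms by simp
    then show ?thesis by (simp add: algebra_simps power2_eq_square)
  qed
  then have mono: "?s \<le> \<rho> / (1 + \<rho>\<^sup>2) * (1 + ?s\<^sup>2)"
    by (simp add: field_simps add_pos_nonneg)
  have halve: "(\<rho> / P * T) * (c * N) = (c * (2 * \<rho> / P)) * (T / 2 * N)" for P T N :: real
    by simp
  have "norm (z * a - z * b) = ?s * norm (a - b)"
    by (simp flip: norm_mult right_diff_distrib)
  also have "\<dots> \<le> (\<rho> / (1 + \<rho>\<^sup>2) * (1 + ?s\<^sup>2)) * (c * norm (1 - ?w))"
    using assms(1) mono s \<rho>0 by (intro mult_mono) (auto simp: pseudohyperbolic_le_def)
  also have "\<dots> = (c * (2 * \<rho> / (1 + \<rho>\<^sup>2))) * ((1 + ?s\<^sup>2) / 2 * norm (1 - ?w))"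
    by (rule halve)
  also have "\<dots> \<le> (c * (2 * \<rho> / (1 + \<rho>\<^sup>2))) * norm (1 - of_real (?s\<^sup>2) * ?w)"
    using assms(2) \<rho>0 by (intro mult_left_mono[OF le]) auto
  finally show ?thesis
    unfolding pseudohyperbolic_le_def D .
qed

text \<open>
  Disc automorphisms multiply \<open>a - b\<close> and \<open>1 - cnj a * b\<close> by numbers of the same modulus \<open>?k\<close>.
\<close>

lemma pseudohyperbolic_le_blaschke:
  assumes "pseudohyperbolic_le c a b" "norm a \<le> 1" "norm b \<le> 1" "norm r < 1"
  shows "pseudohyperbolic_le c ((a + r) / (1 + cnj r * a)) ((b + r) / (1 + cnj r * b))"
proof -
  have nz: "1 + cnj r * a \<noteq> 0" "1 + cnj r * b \<noteq> 0"
    using assms blaschke_denominator_nonzero by simp_all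
  then have nz': "1 + r * cnj a \<noteq> 0"
    by (metis complex_cnj_add complex_cnj_cnj complex_cnj_mult complex_cnj_one complex_cnj_zero_iff)
  have eq: "norm (1 + r * cnj a) = norm (1 + cnj r * a)"
    by (metis complex_cnj_add complex_cnj_cnj complex_cnj_mult complex_cnj_one complex_mod_cnj)
  let ?k = "norm (1 - r * cnj r) / (norm (1 + cnj r * a) * norm (1 + cnj r * b))"
  have "(a + r) / (1 + cnj r * a) - (b + r) / (1 + cnj r * b) =
      (1 - r * cnj r) * (a - b) / ((1 + cnj r * a) * (1 + cnj r * b))"
    using nz by (simp add: divide_simps) (simp add: algebra_simps)
  then have 1: "norm ((a + r) / (1 + cnj r * a) - (b + r) / (1 + cnj r * b)) = ?k * norm (a - b)"
    by (simp add: norm_mult norm_divide)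
  have "1 - cnj ((a + r) / (1 + cnj r * a)) * ((b + r) / (1 + cnj r * b)) =
      (1 - r * cnj r) * (1 - cnj a * b) / ((1 + r * cnj a) * (1 + cnj r * b))"
    using nz nz' by (simp add: divide_simps) (simp add: algebra_simps)
  then have 2: "norm (1 - cnj ((a + r) / (1 + cnj r * a)) * ((b + r) / (1 + cnj r * b))) =
      ?k * norm (1 - cnj a * b)"
    by (simp add: norm_mult norm_divide eq)
  have "?k * norm (a - b) \<le> ?k * (c * norm (1 - cnj a * b))"
    using assms(1) by (intro mult_left_mono) (auto simp: pseudohyperbolic_le_def)
  then show ?thesis
    unfolding pseudohyperbolic_le_def 1 2 by (simp only: mult.left_commute)
qed

section \<open>Convergence of the convergents\<close>

text \<open>
  The recursion of the continued fraction expansion inside the unit ball of bounded holomorphic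
  functions.  Both the convergents and the Taylor coefficients are obtained by iterating it.
\<close>

definition schur_tails ::
  "(nat \<Rightarrow> complex ^ 'd \<Rightarrow> complex) \<Rightarrow> (nat \<Rightarrow> complex) \<Rightarrow> (nat \<Rightarrow> 'd) \<Rightarrow> bool" where
  "schur_tails h r \<nu> \<longleftrightarrow> (\<forall>n. h n \<in> hol_class \<and> r n = h n 0 \<and>
     (\<forall>z\<in>polydisc. h n z = op_g (r n) (op_m (\<nu> (Suc n)) (h (Suc n))) z))"

lemma schur_tailsD:
  assumes "schur_tails h r \<nu>"
  shows "h n \<in> hol_class" "norm (r n) \<le> 1"
    "z \<in> polydisc \<Longrightarrow> norm (h n z) \<le> 1"
    "z \<in> polydisc \<Longrightarrow> h n z = op_g (r n) (op_m (\<nu> (Suc n)) (h (Suc n))) z"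
proof -
  show n: "h n \<in> hol_class" and step: "z \<in> polydisc \<Longrightarrow> h n z = op_g (r n) (op_m (\<nu> (Suc n)) (h (Suc n))) z"
    using assms unfolding schur_tails_def by blast+
  have bound: "norm (h n w) \<le> 1" if "w \<in> polydisc" for w
    using n that by (simp add: hol_class_def)
  then show "z \<in> polydisc \<Longrightarrow> norm (h n z) \<le> 1" .
  have "r n = h n 0" using assms unfolding schur_tails_def by blast
  then show "norm (r n) \<le> 1" using bound[of 0] by (simp add: polydisc_def)
qed

lemma schur_expansion_imp_tails:
  assumes "schur_expansion f r \<nu>"
  obtains h where "h 0 = f" "schur_tails h r \<nu>"
proof -
  have "schur_class \<subseteq> (hol_class :: (complex ^ 'd \<Rightarrow> complex) set)"
    unfolding schur_class_def closure_of_hol_topology by blast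
  then show thesis
    using assms that unfolding schur_expansion_def schur_tails_def by blast
qed

text \<open>
  Downward induction along the continued fraction: at \<open>k = n\<close> the tail is the constant \<open>r\<^sub>n\<close>, and each
  step back multiplies by a coordinate, which contracts, and applies an automorphism, which does not
  expand.  If \<open>norm (r k) = 1\<close>, both values collapse to \<open>r k\<close>.
\<close>

lemma convergent_tail_pseudohyperbolic_le:
  assumes h: "schur_tails h r \<nu>" and z: "\<And>j. norm (z $ j) \<le> \<rho>" and \<rho>: "\<rho> < 1" and "k \<le> n"
  defines "g \<equiv> \<lambda>k. foldr (\<lambda>k h. op_g (r k) (op_m (\<nu> (Suc k)) h)) [k..<n] (op_g (r n) (\<lambda>z. 0)) z"
  shows "norm (g k) \<le> 1 \<and> pseudohyperbolic_le ((2 * \<rho> / (1 + \<rho>\<^sup>2)) ^ (n - k)) (h k z) (g k)"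
  using \<open>k \<le> n\<close>
proof (induction k rule: inc_induct)
  case base
  have z1: "z \<in> polydisc" using z \<rho> by (auto simp: polydisc_def intro: le_less_trans)
  have "g n = r n" by (simp add: g_def op_g_def)
  then show ?case
    using schur_tailsD(2,3)[OF h] z1 norm_diff_le_norm_one_minus by (simp add: pseudohyperbolic_le_def)
next
  case (step k)
  define \<theta> where "\<theta> = 2 * \<rho> / (1 + \<rho>\<^sup>2)"
  have z1: "z \<in> polydisc" using z \<rho> by (auto simp: polydisc_def intro: le_less_trans)
  have \<rho>0: "0 \<le> \<rho>" using z[of undefined] norm_ge_zero order_trans by blast
  let ?a = "z $ \<nu> (Suc k) * h (Suc k) z" and ?b = "z $ \<nu> (Suc k) * g (Suc k)"
  have IH: "norm (g (Suc k)) \<le> 1" "pseudohyperbolic_le (\<theta> ^ (n - Suc k)) (h (Suc k) z) (g (Suc k))"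
    using step.IH by (auto simp: \<theta>_def)
  have ab: "norm ?a \<le> 1" "norm ?b \<le> 1"
    using z[of "\<nu> (Suc k)"] \<rho> IH(1) schur_tailsD(3)[OF h z1] by (auto simp: norm_mult intro!: mult_le_one)
  have "pseudohyperbolic_le (\<theta> ^ (n - Suc k) * \<theta>) ?a ?b"
    unfolding \<theta>_def using IH z \<rho> \<rho>0 schur_tailsD(3)[OF h z1]
    by (intro pseudohyperbolic_le_mult) (auto simp: \<theta>_def)
  then have close: "pseudohyperbolic_le (\<theta> ^ (n - k)) ?a ?b"
    using step.hyps by (simp add: Suc_diff_Suc flip: power_Suc2)
  have hk: "h k z = (if norm (r k) < 1 then (?a + r k) / (1 + cnj (r k) * ?a) else r k)"
    using schur_tailsD(4)[OF h z1, of k] by (simp add: op_g_def op_m_def)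
  have gk: "g k = (if norm (r k) < 1 then (?b + r k) / (1 + cnj (r k) * ?b) else r k)"
    using step.hyps by (simp add: g_def upt_conv_Cons op_g_def op_m_def)
  show ?case
  proof (cases "norm (r k) < 1")
    case True
    then show ?thesis
      unfolding \<theta>_def[symmetric] hk gk using close ab
      by (auto intro!: norm_blaschke_le_1 pseudohyperbolic_le_blaschke)
  next
    case False
    have "0 \<le> \<theta>" using \<rho>0 by (simp add: \<theta>_def)
    with False show ?thesis
      unfolding \<theta>_def[symmetric] hk gk using schur_tailsD(2)[OF h] by (auto simp: pseudohyperbolic_le_def)
  qed
qed

lemma dist_schur_convergent_le:
  assumes h: "schur_tails h r \<nu>" and z: "\<And>j. norm (z $ j) \<le> \<rho>" and \<rho>: "\<rho> < 1"
  shows "dist (schur_convergent r \<nu> n z) (h 0 z) \<le> 2 * (2 * \<rho> / (1 + \<rho>\<^sup>2)) ^ n"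
proof -
  let ?a = "h 0 z" and ?b = "schur_convergent r \<nu> n z"
  have z1: "z \<in> polydisc" using z \<rho> by (auto simp: polydisc_def intro: le_less_trans)
  have \<rho>0: "0 \<le> \<rho>" using z[of undefined] norm_ge_zero order_trans by blast
  have b: "norm ?b \<le> 1" and close: "pseudohyperbolic_le ((2 * \<rho> / (1 + \<rho>\<^sup>2)) ^ n) ?a ?b"
    using convergent_tail_pseudohyperbolic_le[OF h z \<rho>, of 0 n] by (auto simp: schur_convergent_def)
  have "norm (1 - cnj ?a * ?b) \<le> 1 + norm (cnj ?a * ?b)"
    using norm_triangle_ineq4[of 1 "cnj ?a * ?b"] by simp
  also have "\<dots> \<le> 2"
    using b schur_tailsD(3)[OF h z1] by (simp add: norm_mult mult_le_one)
  finally have "norm (1 - cnj ?a * ?b) \<le> 2" .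
  then have "(2 * \<rho> / (1 + \<rho>\<^sup>2)) ^ n * norm (1 - cnj ?a * ?b) \<le> (2 * \<rho> / (1 + \<rho>\<^sup>2)) ^ n * 2"
    using \<rho>0 by (intro mult_left_mono) auto
  with close show ?thesis
    unfolding pseudohyperbolic_le_def dist_norm by (subst norm_minus_commute) simp
qed

text \<open>
  The lower bound on \<open>\<rho>\<close> allows division by it.
\<close>

lemma compact_polydisc_bound:
  fixes K :: "(complex ^ 'd :: finite) set"
  assumes "compact K" "K \<subseteq> polydisc"
  obtains \<rho> where "0 < \<rho>" "\<rho> < 1" "\<And>z j. z \<in> K \<Longrightarrow> norm (z $ j) \<le> \<rho>"
proof -
  have "\<exists>c<1. \<forall>z\<in>K. norm (z $ j) \<le> c" for j
  proof (cases "K = {}")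
    case False
    have "continuous_on K (\<lambda>z. norm (z $ j))"
      by (intro continuous_intros)
    then obtain x where "x \<in> K" "\<forall>z\<in>K. norm (z $ j) \<le> norm (x $ j)"
      using continuous_attains_sup[OF assms(1) False] by blast
    then show ?thesis
      using assms(2) by (intro exI[of _ "norm (x $ j)"]) (auto simp: polydisc_def)
  qed (auto intro: exI[of _ 0])
  then obtain c where c: "\<And>j. c j < 1" "\<And>j z. z \<in> K \<Longrightarrow> norm (z $ j) \<le> c j" by metis
  define \<rho> where "\<rho> = Max (insert (1/2) (range c))"
  have "c j \<le> \<rho>" for j unfolding \<rho>_def by (intro Max_ge) auto
  moreover have "1/2 \<le> \<rho>" unfolding \<rho>_def by (intro Max_ge) auto
  moreover have "\<rho> < 1" unfolding \<rho>_def using c by auto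
  ultimately show thesis
    using c(2) by (intro that[of \<rho>]) (auto intro: order_trans)
qed

lemma uniform_limit_schur_convergent:
  assumes h: "schur_tails h r \<nu>" and K: "compact K" "K \<subseteq> polydisc"
  shows "uniform_limit K (schur_convergent r \<nu>) (h 0) sequentially"
proof -
  obtain \<rho> where \<rho>: "0 < \<rho>" "\<rho> < 1" "\<And>z j. z \<in> K \<Longrightarrow> norm (z $ j) \<le> \<rho>"
    using compact_polydisc_bound[OF K] by blast
  let ?\<theta> = "2 * \<rho> / (1 + \<rho>\<^sup>2)"
  \<comment> \<open>The contraction factor is below \<open>1\<close> because \<open>(1 - \<rho>)\<^sup>2 > 0\<close>.\<close>
  have "0 < (1 - \<rho>)\<^sup>2" using \<rho> by simp
  then have "2 * \<rho> < 1 + \<rho>\<^sup>2" by (simp add: power2_eq_square algebra_simps)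
  then have \<theta>: "norm ?\<theta> < 1" using \<rho>(1) by (simp add: add_pos_nonneg)
  have "(\<lambda>n. 2 * ?\<theta> ^ n) \<longlonglongrightarrow> 2 * 0"
    by (intro tendsto_mult_left LIMSEQ_power_zero \<theta>)
  then have lim: "(\<lambda>n. 2 * ?\<theta> ^ n) \<longlonglongrightarrow> 0" by simp
  show ?thesis
  proof (rule uniform_limitI)
    fix e :: real assume "e > 0"
    with lim have "\<forall>\<^sub>F n in sequentially. 2 * ?\<theta> ^ n < e"
      by (rule order_tendstoD(2))
    then show "\<forall>\<^sub>F n in sequentially. \<forall>z\<in>K. dist (schur_convergent r \<nu> n z) (h 0 z) < e"
      by eventually_elim (use dist_schur_convergent_le[OF h \<rho>(3,2)] in \<open>blast intro: le_less_trans\<close>)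
  qed
qed

section \<open>Taylor coefficients along complex lines\<close>

text \<open>
  The Taylor series of \<open>h\<close> restricted to the complex line through \<open>z\<close>, in the line parameter.  Its
  \<open>k\<close>th coefficient is the homogeneous part of degree \<open>k\<close> of \<open>h\<close>, evaluated at \<open>z\<close>.
\<close>

definition slice_fps :: "(complex ^ 'd \<Rightarrow> complex) \<Rightarrow> complex ^ 'd \<Rightarrow> complex fps" where
  "slice_fps h z = fps_expansion (\<lambda>\<zeta>. h (\<zeta> *s z)) 0"

lemma slice_holomorphic_on:
  fixes h :: "complex ^ 'd :: finite \<Rightarrow> complex"
  assumes "h \<in> hol_class" "\<And>\<zeta>. \<zeta> \<in> S \<Longrightarrow> \<zeta> *s z \<in> polydisc"
  shows "(\<lambda>\<zeta>. h (\<zeta> *s z)) holomorphic_on S"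
  unfolding holomorphic_on_def
proof
  fix \<zeta> assume "\<zeta> \<in> S"
  then obtain L where L: "(h has_derivative L) (at (\<zeta> *s z))" "\<And>c v. L (c *s v) = c * L v"
    using assms unfolding hol_class_def holomorphic_polydisc_def by blast
  have "linear (\<lambda>\<zeta>. \<zeta> *s z)"
    by (rule linearI) (simp_all add: vec_eq_iff algebra_simps)
  then have "((\<lambda>\<zeta>. \<zeta> *s z) has_derivative (\<lambda>\<zeta>. \<zeta> *s z)) (at \<zeta>)"
    by (intro bounded_linear_imp_has_derivative linear_conv_bounded_linear[THEN iffD1])
  from has_derivative_compose[OF this L(1)]
  have "((\<lambda>\<zeta>. h (\<zeta> *s z)) has_field_derivative L z) (at \<zeta>)"
    by (simp add: L(2) has_field_derivative_def mult_commute_abs)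
  then show "(\<lambda>\<zeta>. h (\<zeta> *s z)) field_differentiable at \<zeta> within S"
    using field_differentiable_at_within field_differentiable_def by blast
qed

lemma scaled_in_polydisc:
  fixes z :: "complex ^ 'd"
  assumes "norm \<zeta> \<le> R" "\<And>j. R * norm (z $ j) < 1"
  shows "\<zeta> *s z \<in> polydisc"
proof -
  have "norm (\<zeta> * z $ j) < 1" for j
    using assms(2)[of j] mult_right_mono[OF assms(1), of "norm (z $ j)"] by (simp add: norm_mult)
  then show ?thesis by (simp add: polydisc_def)
qed

lemma slice_has_fps_expansion:
  fixes h :: "complex ^ 'd :: finite \<Rightarrow> complex"
  assumes "h \<in> hol_class" "z \<in> polydisc"
  shows "(\<lambda>\<zeta>. h (\<zeta> *s z)) has_fps_expansion slice_fps h z"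
proof -
  have "(\<lambda>\<zeta>. h (\<zeta> *s z)) holomorphic_on ball 0 1"
    using assms(2) by (intro slice_holomorphic_on[OF assms(1)] scaled_in_polydisc[of _ 1]) (auto simp: polydisc_def)
  then show ?thesis
    unfolding slice_fps_def by (intro has_fps_expansion_fps_expansion[of "ball 0 1"]) auto
qed

text \<open>
  One step of the continued fraction becomes a composition of formal power series.  Clearing the
  denominator gives an identity of holomorphic functions that also holds for \<open>norm (r n) = 1\<close>; as a
  formal power series the denominator has constant term \<open>1\<close> and can be inverted again.
\<close>

lemma slice_fps_step:
  fixes h :: "nat \<Rightarrow> complex ^ 'd :: finite \<Rightarrow> complex"
  assumes h: "schur_tails h r \<nu>" and z: "z \<in> polydisc"
  shows "slice_fps (h n) z =
    blaschke_fps (r n) oo (fps_const (z $ \<nu> (Suc n)) * fps_X * slice_fps (h (Suc n)) z)"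
proof -
  define c where "c = z $ \<nu> (Suc n)"
  define W where "W = fps_const c * fps_X * slice_fps (h (Suc n)) z"
  define F where "F = slice_fps (h n) z"
  let ?W = "\<lambda>\<zeta>. c * \<zeta> * h (Suc n) (\<zeta> *s z)"
  note expansions = slice_has_fps_expansion[OF schur_tailsD(1)[OF h] z]
  have W: "?W has_fps_expansion W"
    unfolding W_def by (intro fps_expansion_intros expansions)
  have lhs: "(\<lambda>\<zeta>. h n (\<zeta> *s z) * (1 + cnj (r n) * ?W \<zeta>)) has_fps_expansion
      F * (1 + fps_const (cnj (r n)) * W)"
    unfolding F_def by (intro fps_expansion_intros expansions W)
  have rhs: "(\<lambda>\<zeta>. ?W \<zeta> + r n) has_fps_expansion W + fps_const (r n)"
    by (intro fps_expansion_intros W)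
  have "h n (\<zeta> *s z) * (1 + cnj (r n) * ?W \<zeta>) = ?W \<zeta> + r n" if "\<zeta> \<in> ball 0 1" for \<zeta>
  proof -
    have \<zeta>: "\<zeta> *s z \<in> polydisc"
      using that z by (intro scaled_in_polydisc[of _ 1]) (auto simp: polydisc_def)
    let ?w = "(\<zeta> *s z) $ \<nu> (Suc n) * h (Suc n) (\<zeta> *s z)"
    have w: "?W \<zeta> = ?w" by (simp add: c_def)
    have step: "h n (\<zeta> *s z) = (if norm (r n) < 1 then (?w + r n) / (1 + cnj (r n) * ?w) else r n)"
      using schur_tailsD(4)[OF h \<zeta>, of n] by (simp add: op_g_def op_m_def)
    show ?thesis
    proof (cases "norm (r n) < 1")
      case True
      have "norm ?w \<le> 1"
        using schur_tailsD(3)[OF h \<zeta>] \<zeta> unfolding norm_mult polydisc_def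
        by (intro mult_le_one) (auto intro: less_imp_le)
      then have "1 + cnj (r n) * ?w \<noteq> 0"
        using True by (intro blaschke_denominator_nonzero) auto
      with True show ?thesis unfolding w step by simp
    next
      case False
      then have "norm (r n) = 1" using schur_tailsD(2)[OF h, of n] by simp
      then have "r n * cnj (r n) = 1" by (simp flip: complex_norm_square)
      then have "r n * (1 + cnj (r n) * ?w) = ?w + r n"
        by (simp add: distrib_left flip: mult.assoc)
      with False show ?thesis unfolding w step by simp
    qed
  qed
  then have "\<forall>\<^sub>F \<zeta> in nhds 0. h n (\<zeta> *s z) * (1 + cnj (r n) * ?W \<zeta>) = ?W \<zeta> + r n"
    using eventually_nhds_in_open[of "ball (0::complex) 1" 0] by (auto elim: eventually_mono)
  then have "(\<lambda>\<zeta>. h n (\<zeta> *s z) * (1 + cnj (r n) * ?W \<zeta>)) has_fps_expansion W + fps_const (r n)"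
    using rhs by (subst has_fps_expansion_cong[OF _ refl]) auto
  then have eq: "F * (1 + fps_const (cnj (r n)) * W) = W + fps_const (r n)"
    using lhs fps_expansion_unique_complex by blast
  \<comment> \<open>Undo the clearing of denominators on the formal side.\<close>
  let ?D = "1 + fps_const (cnj (r n)) * W"
  have W0: "fps_nth W 0 = 0" by (simp add: W_def)
  have "blaschke_fps (r n) oo W = (W + fps_const (r n)) * inverse ?D"
    unfolding blaschke_fps_def using W0
    by (simp add: fps_compose_mult_distrib fps_inverse_compose fps_compose_add_distrib)
  also have "\<dots> = F * (inverse ?D * ?D)"
    unfolding eq[symmetric] by (simp only: mult_ac)
  also have "inverse ?D * ?D = 1"
    by (rule inverse_mult_eq_1) (simp add: W0)
  finally show ?thesis by (simp add: W_def F_def c_def)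
qed

text \<open>
  The inner series is divisible by \<open>fps_X\<close>, so only its powers up to \<open>k\<close> contribute to degree \<open>k\<close>, and
  for \<open>k > 0\<close> the zeroth power does not contribute.  The remaining degree \<open>k - q\<close> is smaller
  than \<open>k\<close>.
\<close>

lemma slice_fps_power_nth:
  fixes h :: "nat \<Rightarrow> complex ^ 'd :: finite \<Rightarrow> complex"
  assumes h: "schur_tails h r \<nu>" and z: "z \<in> polydisc"
  shows "fps_nth (slice_fps (h n) z ^ p) k =
    (if k = 0 then scattering_poly p 0 (r n)
     else \<Sum>q = 1..k. scattering_poly p q (r n) * (z $ \<nu> (Suc n)) ^ q *
       fps_nth (slice_fps (h (Suc n)) z ^ q) (k - q))"
proof -
  define c where "c = z $ \<nu> (Suc n)"
  define G where "G = slice_fps (h (Suc n)) z"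
  have nth: "fps_nth ((fps_const c * fps_X * G) ^ q) k = c ^ q * fps_nth (G ^ q) (k - q)"
    if "q \<le> k" for q
    using that by (simp add: power_mult_distrib fps_X_power_mult_nth mult.assoc)
  have "fps_nth (slice_fps (h n) z ^ p) k =
      fps_nth (blaschke_fps (r n) ^ p oo (fps_const c * fps_X * G)) k"
    unfolding c_def G_def
    by (subst slice_fps_step[OF h z, of n], subst fps_compose_power) auto
  also have "\<dots> = (\<Sum>q = 0..k. scattering_poly p q (r n) * (c ^ q * fps_nth (G ^ q) (k - q)))"
    unfolding fps_compose_nth fps_nth_blaschke_power by (intro sum.cong refl) (simp add: nth)
  also have "\<dots> = scattering_poly p 0 (r n) * fps_nth 1 k +
      (\<Sum>q = 1..k. scattering_poly p q (r n) * (c ^ q * fps_nth (G ^ q) (k - q)))"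
    by (subst sum.atLeast_Suc_atMost) auto
  finally show ?thesis by (simp add: c_def G_def mult.assoc)
qed

section \<open>Unfolding the recursion over compositions\<close>

definition compositions :: "nat \<Rightarrow> nat list set" where
  "compositions k = {xs. sum_list xs = k \<and> 0 \<notin> set xs}"

lemma compositions_0: "compositions 0 = {[]}"
proof -
  have "xs = []" if "sum_list xs = 0" "0 \<notin> set xs" for xs :: "nat list"
    using that by (cases xs) auto
  then show ?thesis by (auto simp: compositions_def)
qed

lemma compositions_pos:
  assumes "k > 0"
  shows "compositions k = (\<Union>q\<in>{1..k}. (#) q ` compositions (k - q))"
proof (intro equalityI subsetI)
  fix xs assume xs: "xs \<in> compositions k"
  then obtain q ys where "xs = q # ys"
    using assms by (cases xs) (auto simp: compositions_def)
  with xs show "xs \<in> (\<Union>q\<in>{1..k}. (#) q ` compositions (k - q))"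
    by (auto simp: compositions_def intro!: bexI[of _ q])
qed (auto simp: compositions_def)

lemma finite_compositions: "finite (compositions k)"
proof (induction k rule: less_induct)
  case (less k)
  then show ?case
    by (cases "k = 0") (auto simp: compositions_0 compositions_pos)
qed

lemma sum_compositions_pos:
  assumes "k > 0"
  shows "(\<Sum>xs\<in>compositions k. g xs) = (\<Sum>q = 1..k. \<Sum>ys\<in>compositions (k - q). g (q # ys))"
proof -
  have "(\<Sum>xs\<in>compositions k. g xs) = (\<Sum>q = 1..k. \<Sum>xs\<in>(#) q ` compositions (k - q). g xs)"
    unfolding compositions_pos[OF assms]
    by (rule sum.UNION_disjoint) (auto simp: finite_compositions)
  then show ?thesis by (simp add: sum.reindex)
qed

text \<open>
  The argument \<open>n\<close> is the current level of the continued fraction and \<open>p\<close> the power of \<open>h\<^sub>n\<close> that is being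
  expanded; each entry \<open>q\<close> of the list is the power of \<open>h\<^sub>n\<^sub>+\<^sub>1\<close> chosen at that level, and the empty list
  stands for a constant term.
\<close>

fun composition_weight :: "(nat \<Rightarrow> complex) \<Rightarrow> nat \<Rightarrow> nat \<Rightarrow> nat list \<Rightarrow> complex" where
  "composition_weight r n p [] = scattering_poly p 0 (r n)"
| "composition_weight r n p (q # xs) = scattering_poly p q (r n) * composition_weight r (Suc n) q xs"

fun composition_monomial :: "(nat \<Rightarrow> 'd) \<Rightarrow> nat \<Rightarrow> nat list \<Rightarrow> complex ^ 'd \<Rightarrow> complex" where
  "composition_monomial \<nu> n [] z = 1"
| "composition_monomial \<nu> n (q # xs) z =
     (z $ \<nu> (Suc n)) ^ q * composition_monomial \<nu> (Suc n) xs z"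

text \<open>
  Induction on the degree, splitting off the first entry of a composition.  The generalization from
  \<open>h\<^sub>0\<close> to arbitrary powers of all \<open>h\<^sub>n\<close> is what makes the recursion close up.
\<close>

theorem slice_fps_power_eq_sum_compositions:
  fixes h :: "nat \<Rightarrow> complex ^ 'd :: finite \<Rightarrow> complex"
  assumes h: "schur_tails h r \<nu>" and z: "z \<in> polydisc"
  shows "fps_nth (slice_fps (h n) z ^ p) k =
    (\<Sum>xs\<in>compositions k. composition_weight r n p xs * composition_monomial \<nu> n xs z)"
proof (induction k arbitrary: n p rule: less_induct)
  case (less k)
  show ?case
  proof (cases "k = 0")
    case True
    then show ?thesis by (simp add: slice_fps_power_nth[OF h z] compositions_0)
  next
    case False
    have "fps_nth (slice_fps (h n) z ^ p) k =
        (\<Sum>q = 1..k. scattering_poly p q (r n) * (z $ \<nu> (Suc n)) ^ q *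
           fps_nth (slice_fps (h (Suc n)) z ^ q) (k - q))"
      using False by (subst slice_fps_power_nth[OF h z]) simp
    also have "\<dots> = (\<Sum>q = 1..k. \<Sum>ys\<in>compositions (k - q).
        composition_weight r n p (q # ys) * composition_monomial \<nu> n (q # ys) z)"
      by (intro sum.cong refl, subst less.IH) (auto simp: sum_distrib_left mult_ac)
    finally show ?thesis
      using False by (simp only: sum_compositions_pos)
  qed
qed

section \<open>Compositions as active multi-indices\<close>

definition multi_index_of :: "nat list \<Rightarrow> nat \<Rightarrow> nat" where
  "multi_index_of xs j = (if 1 \<le> j \<and> j \<le> length xs then xs ! (j - 1) else 0)"

lemma multi_index_of_simps:
  "multi_index_of xs 0 = 0"
  "multi_index_of [] j = 0"
  "multi_index_of (q # xs) (Suc 0) = q"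
  "multi_index_of (q # xs) (Suc (Suc i)) = multi_index_of xs (Suc i)"
  by (auto simp: multi_index_of_def)

lemma supp_multi_index_of:
  assumes "0 \<notin> set xs"
  shows "supp (multi_index_of xs) = {1..length xs}"
proof -
  have "xs ! i \<noteq> 0" if "i < length xs" for i
    using assms that by (metis nth_mem)
  then show ?thesis by (auto simp: supp_def multi_index_of_def)
qed

lemma inj_on_multi_index_of: "inj_on multi_index_of {xs. 0 \<notin> set xs}"
proof (rule inj_onI)
  fix xs ys assume xy: "xs \<in> {xs. 0 \<notin> set xs}" "ys \<in> {xs. 0 \<notin> set xs}"
    and eq: "multi_index_of xs = multi_index_of ys"
  have "length xs = card (supp (multi_index_of xs))" "length ys = card (supp (multi_index_of ys))"
    using xy by (simp_all add: supp_multi_index_of)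
  then have len: "length xs = length ys" by (simp add: eq)
  moreover have "xs ! i = ys ! i" if "i < length xs" for i
    using fun_cong[OF eq, of "Suc i"] that len by (simp add: multi_index_of_def)
  ultimately show "xs = ys" by (rule nth_equalityI)
qed

lemma composition_weight_eq_prod:
  "composition_weight r n p xs = scattering_poly p (multi_index_of xs 1) (r n) *
     (\<Prod>i<length xs. scattering_poly (multi_index_of xs (Suc i)) (multi_index_of xs (Suc (Suc i)))
        (r (n + Suc i)))"
proof (induction xs arbitrary: n p)
  case (Cons q xs)
  then show ?case
    by (simp add: prod.lessThan_Suc_shift multi_index_of_simps del: prod.lessThan_Suc)
qed (simp add: multi_index_of_simps)

lemma composition_monomial_eq_prod:
  "composition_monomial \<nu> n xs z = (\<Prod>i<length xs. (z $ \<nu> (n + Suc i)) ^ multi_index_of xs (Suc i))"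
  by (induction xs arbitrary: n)
     (simp_all add: prod.lessThan_Suc_shift multi_index_of_simps del: prod.lessThan_Suc)

lemma scattering_weight_multi_index_of:
  assumes "0 \<notin> set xs"
  shows "scattering_weight (multi_index_of xs) r = composition_weight r 0 1 xs"
proof -
  have "(if {1..length xs} = {} then 0 else Max {1..length xs}) = length xs"
    by (cases xs) (auto intro!: Max_eqI)
  then show ?thesis
    unfolding scattering_weight_def supp_multi_index_of[OF assms] composition_weight_eq_prod Let_def
    by (simp add: prod.atLeast1_atMost_eq)
qed

lemma alloc_monomial_multi_index_of:
  assumes "0 \<notin> set xs"
  shows "alloc_monomial \<nu> (multi_index_of xs) z = composition_monomial \<nu> 0 xs z"
  unfolding alloc_monomial_def supp_multi_index_of[OF assms] composition_monomial_eq_prod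
  by (simp add: prod.atLeast1_atMost_eq)

lemma multi_degree_multi_index_of:
  assumes "0 \<notin> set xs"
  shows "multi_degree (multi_index_of xs) = sum_list xs"
  unfolding multi_degree_def supp_multi_index_of[OF assms] sum_list_sum_nth
  by (simp add: sum.atLeast1_atMost_eq multi_index_of_def atLeast0LessThan)

lemma multi_index_of_in_multi_indices:
  assumes "0 \<notin> set xs"
  shows "multi_index_of xs \<in> multi_indices"
  by (simp add: multi_indices_def supp_multi_index_of[OF assms] multi_index_of_simps)

text \<open>
  If the support had a gap, then \<open>\<alpha> j = 0\<close> and \<open>\<alpha> (Suc j) > 0\<close> for some \<open>j\<close> below the maximum of
  the support, and the weight would contain the vanishing factor \<open>\<phi>\<^sup>(\<^sup>0\<^sup>,\<^sup>q\<^sup>)\<close> with \<open>q > 0\<close>.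
\<close>

lemma nonzero_weight_imp_composition:
  assumes \<alpha>: "\<alpha> \<in> multi_indices" and nz: "scattering_weight \<alpha> r \<noteq> 0"
  obtains xs where "0 \<notin> set xs" "\<alpha> = multi_index_of xs"
proof -
  define N where "N = (if supp \<alpha> = {} then 0 else Max (supp \<alpha>))"
  have fin: "finite (supp \<alpha>)" and \<alpha>0: "\<alpha> 0 = 0" using \<alpha> by (auto simp: multi_indices_def)
  have beyond: "\<alpha> j = 0" if "j > N" for j
  proof (rule ccontr)
    assume "\<alpha> j \<noteq> 0"
    then have "j \<in> supp \<alpha>" by (simp add: supp_def)
    with fin that show False by (auto simp: N_def split: if_splits)
  qed
  have factor: "scattering_poly (\<alpha> j) (\<alpha> (Suc j)) (r j) \<noteq> 0" if "j \<in> {1..N}" for j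
    using nz that unfolding scattering_weight_def N_def[symmetric] Let_def by auto
  have pos: "\<alpha> j \<noteq> 0" if "1 \<le> j" "j \<le> N" for j
    using that(2,1)
  proof (induction j rule: inc_induct)
    case base
    then have "supp \<alpha> \<noteq> {}" "N = Max (supp \<alpha>)" by (auto simp: N_def split: if_splits)
    then have "N \<in> supp \<alpha>" using fin Max_in by metis
    then show ?case by (simp add: supp_def)
  next
    case (step j)
    have "scattering_poly 0 (\<alpha> (Suc j)) (r j) = 0"
      using step by (simp add: scattering_poly_def)
    then show ?case using factor[of j] step by (cases "\<alpha> j = 0") auto
  qed
  define xs where "xs = map \<alpha> [1..<Suc N]"
  have "\<alpha> = multi_index_of xs"
  proof
    fix j
    show "\<alpha> j = multi_index_of xs j"
    proof (cases "1 \<le> j \<and> j \<le> N")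
      case True
      then obtain i where "j = Suc i" "i < N" by (cases j) auto
      then show ?thesis by (simp add: multi_index_of_def xs_def del: upt_Suc)
    next
      case False
      then have "j = 0 \<or> j > N" by auto
      then show ?thesis
        using \<alpha>0 beyond by (auto simp: multi_index_of_def xs_def simp del: upt_Suc)
    qed
  qed
  moreover have "0 \<notin> set xs" using pos by (fastforce simp: xs_def less_Suc_eq_le simp del: upt_Suc)
  ultimately show thesis using that by blast
qed

lemma active_indices_subset:
  "active_indices r m \<subseteq> multi_index_of ` (\<Union>k\<le>m. compositions k)"
proof
  fix \<alpha> assume \<alpha>: "\<alpha> \<in> active_indices r m"
  then obtain xs where xs: "0 \<notin> set xs" "\<alpha> = multi_index_of xs"
    by (auto simp: active_indices_def elim: nonzero_weight_imp_composition)
  with \<alpha> have "sum_list xs \<le> m"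
    by (simp add: active_indices_def multi_degree_multi_index_of)
  with xs show "\<alpha> \<in> multi_index_of ` (\<Union>k\<le>m. compositions k)"
    by (auto simp: compositions_def)
qed

lemma finite_active_indices: "finite (active_indices r m)"
  by (rule finite_subset[OF active_indices_subset]) (simp add: finite_compositions)

text \<open>
  Compositions of weight zero may be added to the partial sum freely, which turns its index set into
  one that is independent of the parameters.
\<close>

lemma scattering_partial_sum_eq_taylor:
  fixes h :: "nat \<Rightarrow> complex ^ 'd :: finite \<Rightarrow> complex"
  assumes h: "schur_tails h r \<nu>" and z: "z \<in> polydisc"
  shows "scattering_partial_sum r \<nu> m z = (\<Sum>k\<le>m. fps_nth (slice_fps (h 0) z) k)"
proof -
  let ?C = "\<Union>k\<le>m. compositions k"
  let ?t = "\<lambda>\<alpha>. scattering_weight \<alpha> r * alloc_monomial \<nu> \<alpha> z"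
  have C: "0 \<notin> set xs" "sum_list xs \<le> m" if "xs \<in> ?C" for xs
    using that by (auto simp: compositions_def)
  have "scattering_partial_sum r \<nu> m z = (\<Sum>\<alpha>\<in>multi_index_of ` ?C. ?t \<alpha>)"
    unfolding scattering_partial_sum_def
  proof (rule sum.mono_neutral_left[OF _ active_indices_subset])
    show "\<forall>\<alpha>\<in>multi_index_of ` ?C - active_indices r m. ?t \<alpha> = 0"
    proof
      fix \<alpha> assume \<alpha>: "\<alpha> \<in> multi_index_of ` ?C - active_indices r m"
      then obtain xs where xs: "xs \<in> ?C" "\<alpha> = multi_index_of xs" by blast
      have "\<alpha> \<in> multi_indices" "multi_degree \<alpha> \<le> m"
        using C[OF xs(1)] xs(2)
        by (simp_all add: multi_degree_multi_index_of multi_index_of_in_multi_indices)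
      with \<alpha> show "?t \<alpha> = 0" by (auto simp: active_indices_def)
    qed
  qed (simp add: finite_compositions)
  also have "\<dots> = (\<Sum>xs\<in>?C. ?t (multi_index_of xs))"
    using C(1) by (intro sum.reindex_cong[OF inj_on_subset[OF inj_on_multi_index_of]]) auto
  also have "\<dots> = (\<Sum>xs\<in>?C. composition_weight r 0 1 xs * composition_monomial \<nu> 0 xs z)"
    using C(1) by (intro sum.cong refl)
      (simp add: scattering_weight_multi_index_of alloc_monomial_multi_index_of)
  also have "\<dots> = (\<Sum>k\<le>m. \<Sum>xs\<in>compositions k. composition_weight r 0 1 xs * composition_monomial \<nu> 0 xs z)"
    by (rule sum.UNION_disjoint) (simp_all add: finite_compositions, auto simp: compositions_def)
  also have "\<dots> = (\<Sum>k\<le>m. fps_nth (slice_fps (h 0) z) k)"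
    using slice_fps_power_eq_sum_compositions[OF h z, of 0 1] by simp
  finally show ?thesis .
qed

section \<open>Uniform convergence of the series\<close>

lemma norm_slice_fps_nth_le:
  fixes h :: "complex ^ 'd :: finite \<Rightarrow> complex"
  assumes h: "h \<in> hol_class" and R: "R > 0" "\<And>j. R * norm (z $ j) < 1"
  shows "norm (fps_nth (slice_fps h z) k) \<le> (1 / R) ^ k"
proof -
  let ?s = "\<lambda>\<zeta>. h (\<zeta> *s z)"
  have disc: "\<zeta> *s z \<in> polydisc" if "norm \<zeta> \<le> R" for \<zeta>
    using that R(2) by (rule scaled_in_polydisc)
  have hol: "?s holomorphic_on cball 0 R"
    using disc by (intro slice_holomorphic_on[OF h]) simp
  have "norm ((deriv ^^ k) ?s 0) \<le> fact k * 1 / R ^ k"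
  proof (rule Cauchy_inequality[OF _ _ R(1)])
    show "?s holomorphic_on ball 0 R"
      using hol by (rule holomorphic_on_subset) auto
    show "continuous_on (cball 0 R) ?s"
      using hol by (rule holomorphic_on_imp_continuous_on)
    show "norm (?s \<zeta>) \<le> 1" if "norm (0 - \<zeta>) = R" for \<zeta>
      using disc[of \<zeta>] that h by (auto simp: hol_class_def)
  qed
  then show ?thesis
    by (simp add: slice_fps_def fps_expansion_def norm_divide field_simps power_divide)
qed

lemma slice_fps_sums:
  fixes h :: "complex ^ 'd :: finite \<Rightarrow> complex"
  assumes h: "h \<in> hol_class" and R: "R > 1" "\<And>j. R * norm (z $ j) < 1"
  shows "fps_nth (slice_fps h z) sums h z"
proof -
  have "(\<lambda>\<zeta>. h (\<zeta> *s z)) holomorphic_on ball 0 R"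
    using R(2) by (intro slice_holomorphic_on[OF h] scaled_in_polydisc[of _ R]) auto
  from holomorphic_power_series[OF this, of 1] R(1)
  have "(\<lambda>n. (deriv ^^ n) (\<lambda>\<zeta>. h (\<zeta> *s z)) 0 / fact n) sums h z" by simp
  moreover have "fps_nth (slice_fps h z) = (\<lambda>n. (deriv ^^ n) (\<lambda>\<zeta>. h (\<zeta> *s z)) 0 / fact n)"
    by (simp add: fun_eq_iff slice_fps_def fps_expansion_def)
  ultimately show ?thesis by simp
qed

text \<open>
  The restrictions to the lines through the points of a compact set are holomorphic on a common disc
  of radius \<open>R > 1\<close>, so the Cauchy
  estimates give the geometric majorant \<open>(1 / R) ^ k\<close>.
\<close>

lemma uniform_limit_taylor:
  fixes h :: "complex ^ 'd :: finite \<Rightarrow> complex"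
  assumes h: "h \<in> hol_class" and K: "compact K" "K \<subseteq> polydisc"
  shows "uniform_limit K (\<lambda>m z. \<Sum>k\<le>m. fps_nth (slice_fps h z) k) h sequentially"
proof -
  obtain \<rho> where \<rho>: "0 < \<rho>" "\<rho> < 1" "\<And>z j. z \<in> K \<Longrightarrow> norm (z $ j) \<le> \<rho>"
    using compact_polydisc_bound[OF K] by blast
  obtain R where R: "1 < R" "R < 1 / \<rho>" using dense[of 1 "1 / \<rho>"] \<rho> by auto
  have Rz: "R * norm (z $ j) < 1" if "z \<in> K" for z j
  proof -
    have "R * norm (z $ j) \<le> R * \<rho>" using \<rho>(3)[OF that] R by (intro mult_left_mono) auto
    also have "\<dots> < 1" using R \<rho> by (simp add: field_simps)
    finally show ?thesis .
  qed
  have "uniform_limit K (\<lambda>m z. \<Sum>k<m. fps_nth (slice_fps h z) k)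
      (\<lambda>z. \<Sum>k. fps_nth (slice_fps h z) k) sequentially"
  proof (rule Weierstrass_m_test)
    show "norm (fps_nth (slice_fps h z) k) \<le> (1 / R) ^ k" if "z \<in> K" for k z
      using R Rz[OF that] by (intro norm_slice_fps_nth_le[OF h]) auto
    show "summable (\<lambda>k. (1 / R) ^ k)"
      using R by (intro summable_geometric) auto
  qed
  then have "uniform_limit K (\<lambda>m z. \<Sum>k<Suc m. fps_nth (slice_fps h z) k)
      (\<lambda>z. \<Sum>k. fps_nth (slice_fps h z) k) sequentially"
    by (rule filterlim_compose[OF _ filterlim_Suc])
  moreover have "(\<Sum>k. fps_nth (slice_fps h z) k) = h z" if "z \<in> K" for z
    using slice_fps_sums[OF h R(1) Rz[OF that]] by (simp add: sums_iff)
  ultimately show ?thesis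
    unfolding lessThan_Suc_atMost by (subst (asm) uniform_limit_cong'[OF refl]) auto
qed

theorem theorem1:
  fixes f :: "complex ^ 'd :: {finite, linorder} \<Rightarrow> complex"
    and r :: "nat \<Rightarrow> complex"
    and \<nu> :: "nat \<Rightarrow> 'd"
  assumes "f \<in> schur_class"
    and "schur_expansion f r \<nu>"
  shows "(\<forall>K. compact K \<and> K \<subseteq> polydisc \<longrightarrow>
            uniform_limit K (schur_convergent r \<nu>) f sequentially) \<and>
         (\<forall>m. finite (active_indices r m)) \<and>
         (\<forall>z\<in>polydisc. (\<lambda>m. scattering_partial_sum r \<nu> m z) \<longlonglongrightarrow> f z) \<and>
         (\<forall>K. compact K \<and> K \<subseteq> polydisc \<longrightarrow>
            uniform_limit K (scattering_partial_sum r \<nu>) f sequentially)"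
proof -
  obtain h where f: "h 0 = f" and h: "schur_tails h r \<nu>"
    using schur_expansion_imp_tails[OF assms(2)] .
  have conv: "uniform_limit K (schur_convergent r \<nu>) f sequentially"
    if "compact K" "K \<subseteq> polydisc" for K
    using uniform_limit_schur_convergent[OF h that] by (simp only: f)
  have series: "uniform_limit K (scattering_partial_sum r \<nu>) f sequentially"
    if K: "compact K" "K \<subseteq> polydisc" for K
  proof -
    have "uniform_limit K (\<lambda>m z. \<Sum>k\<le>m. fps_nth (slice_fps f z) k) f sequentially"
      using uniform_limit_taylor[OF schur_tailsD(1)[OF h] K, of 0] by (simp only: f)
    moreover have "scattering_partial_sum r \<nu> m z = (\<Sum>k\<le>m. fps_nth (slice_fps f z) k)"
      if "z \<in> K" for m z
      using scattering_partial_sum_eq_taylor[OF h] K that f by blast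
    ultimately show ?thesis
      by (subst uniform_limit_cong'[OF _ refl]) auto
  qed
  have "(\<lambda>m. scattering_partial_sum r \<nu> m z) \<longlonglongrightarrow> f z" if "z \<in> polydisc" for z
    using tendsto_uniform_limitI[OF series[of "{z}"], of z] that by simp
  then show ?thesis
    using conv series finite_active_indices by blast
qed

end
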